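(* Let $k$ be a positive integer and let $w\in\mathbb{Z}/k\mathbb{Z}$ be an element of multiplicative order $c$, where $c\mid k$. Then any automorphism of the directed graph $G(k,c,w)$ is determined by its action on the set of $k$ idempotent vertices, and the automorphism group of $G(k,c,w)$ is isomorphic to a subgroup of the symmetric group $S_k$.
   Context: For a positive integer $k$ and an element $w$ of multiplicative order $c$ in $\mathbb{Z}/k\mathbb{Z}$ (so $w$ is a unit mod $k$) with $c\mid k$, the directed graph $G(k,c,w)$ (loops allowed) has vertex set $\mathbb{Z}/k\mathbb{Z}\times\mathbb{Z}/k\mathbb{Z}$, and its edges are all the directed edges $(p,i)\to(p+w^j i,\,j)$ with $p,i,j\in\mathbb{Z}/k\mathbb{Z}$. Here $w^j$ for $j\in\mathbb{Z}/k\mathbb{Z}$ is well defined because $c\mid k$. The idempotent vertices of a directed graph are the vertices with loops; in $G(k,c,w)$ these are exactly the $k$ vertices $(x,0)$, $x\in\mathbb{Z}/k\mathbb{Z}$, and any automorphism permutes them among themselves. *)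

theory Defs
  imports
    "HOL-Algebra.Bij"
    "HOL-Algebra.Sym_Groups"
    "HOL-Number_Theory.Number_Theory"
    "Graph_Theory.Pair_Digraph"
    "Graph_Theory.Digraph_Isomorphism"
begin

text \<open>
  Residue classes modulo k are represented by their least natural representatives
  in {0..<k}. The graph depends on c only through w, so c is not a parameter here.
  The exponent j of w is the representative of its class; when the order of w
  divides k this choice does not matter, see \<open>power_residue_well_defined\<close> below.
\<close>

definition Gkw :: "nat \<Rightarrow> nat \<Rightarrow> (nat \<times> nat) pair_pre_digraph" where
  "Gkw k w =
    \<lparr>pverts = {0..<k} \<times> {0..<k},
     parcs = {((p, i), ((p + w ^ j * i) mod k, j)) | p i j. p < k \<and> i < k \<and> j < k}\<rparr>"

definition idempotent_verts :: "'a pair_pre_digraph \<Rightarrow> 'a set" where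
  "idempotent_verts G = {v \<in> pverts G. (v, v) \<in> parcs G}"

text \<open>
  As in \<^const>\<open>AutoGroup\<close>, automorphisms are taken extensional, so that equality of
  functions is equality on the vertex set.
\<close>

definition digraph_auto :: "'a pair_pre_digraph \<Rightarrow> ('a \<Rightarrow> 'a) set" where
  "digraph_auto G =
    {f \<in> Bij (pverts G).
      \<forall>u \<in> pverts G. \<forall>v \<in> pverts G. (f u, f v) \<in> parcs G \<longleftrightarrow> (u, v) \<in> parcs G}"

definition digraph_AutoGroup :: "'a pair_pre_digraph \<Rightarrow> ('a \<Rightarrow> 'a) monoid" where
  "digraph_AutoGroup G = BijGroup (pverts G) \<lparr>carrier := digraph_auto G\<rparr>"

lemma power_residue_well_defined:
  fixes k w :: nat
  assumes "coprime k w" and "ord k w dvd k" and "[j = j'] (mod k)"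
  shows "[w ^ j = w ^ j'] (mod k)"
  using assms order_divides_expdiff cong_dvd_modulus_nat by blast

lemma pair_wf_digraph_Gkw: "pair_wf_digraph (Gkw k w)"
  by unfold_locales (auto simp: Gkw_def)

lemma idempotent_verts_Gkw:
  assumes "coprime k w" and "k > 0"
  shows "idempotent_verts (Gkw k w) = {0..<k} \<times> {0}"
proof -
  have "i = 0" if "p < k" "i < k" "(p + w ^ i * i) mod k = p" for p i
  proof -
    have "[p + w ^ i * i = p + 0] (mod k)"
      using that by (simp add: cong_def)
    then have "[w ^ i * i = 0] (mod k)"
      by (simp only: cong_add_lcancel_nat)
    then have "k dvd w ^ i * i" by (simp add: cong_0_iff)
    then have "k dvd i"
      using assms(1) by (simp add: coprime_dvd_mult_right_iff)
    then show ?thesis using \<open>i < k\<close> by (auto dest: dvd_imp_le)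
  qed
  then show ?thesis
    using assms(2) by (auto simp: idempotent_verts_def Gkw_def)
qed

lemma digraph_auto_inv_into:
  assumes "f \<in> digraph_auto G"
  shows "restrict (inv_into (pverts G) f) (pverts G) \<in> digraph_auto G"
proof -
  let ?g = "inv_into (pverts G) f"
  from assms have f: "f \<in> Bij (pverts G)" and
    arcs: "\<And>u v. u \<in> pverts G \<Longrightarrow> v \<in> pverts G \<Longrightarrow> (f u, f v) \<in> parcs G \<longleftrightarrow> (u, v) \<in> parcs G"
    by (auto simp: digraph_auto_def)
  have "?g v \<in> pverts G" "f (?g v) = v" if "v \<in> pverts G" for v
    using f that Bij_inv_into_mem by (fastforce simp: Bij_def bij_betw_def f_inv_into_f)+
  then have "(?g u, ?g v) \<in> parcs G \<longleftrightarrow> (u, v) \<in> parcs G"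
    if "u \<in> pverts G" "v \<in> pverts G" for u v
    using arcs that by metis
  then show ?thesis
    using restrict_inv_into_Bij[OF f] by (simp add: digraph_auto_def)
qed

lemma subgroup_digraph_auto: "subgroup (digraph_auto G) (BijGroup (pverts G))"
proof (rule subgroup.intro)
  show "digraph_auto G \<subseteq> carrier (BijGroup (pverts G))"
    by (auto simp: digraph_auto_def BijGroup_def)
next
  fix f g assume fg: "f \<in> digraph_auto G" "g \<in> digraph_auto G"
  then have mem: "f \<in> Bij (pverts G)" "g \<in> Bij (pverts G)"
    by (auto simp: digraph_auto_def)
  then have "g v \<in> pverts G" if "v \<in> pverts G" for v
    using that by (auto simp: Bij_def bij_betw_def)
  then show "f \<otimes>\<^bsub>BijGroup (pverts G)\<^esub> g \<in> digraph_auto G"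
    using fg mem compose_Bij[OF mem]
    by (simp add: digraph_auto_def BijGroup_def compose_eq)
next
  show "\<one>\<^bsub>BijGroup (pverts G)\<^esub> \<in> digraph_auto G"
    by (simp add: digraph_auto_def BijGroup_def id_Bij)
next
  fix f assume f: "f \<in> digraph_auto G"
  then have "f \<in> Bij (pverts G)" by (simp add: digraph_auto_def)
  then show "inv\<^bsub>BijGroup (pverts G)\<^esub> f \<in> digraph_auto G"
    using digraph_auto_inv_into[OF f] by (simp add: inv_BijGroup)
qed

lemma group_digraph_AutoGroup: "group (digraph_AutoGroup G)"
  by (simp add: digraph_AutoGroup_def subgroup.subgroup_is_group subgroup_digraph_auto
      group_BijGroup)

text \<open>
  \<^const>\<open>digraph_auto\<close> consists of the vertex maps of those isomorphisms, in the sense of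
  \<open>pre_digraph.digraph_isomorphism\<close>, that map the digraph onto itself.
\<close>

lemma digraph_auto_iff_digraph_isomorphism:
  assumes "pair_wf_digraph G"
  shows "f \<in> digraph_auto G \<longleftrightarrow>
    f \<in> extensional (pverts G) \<and>
    (\<exists>h. pre_digraph.digraph_isomorphism (with_proj G) h \<and>
         app_iso h (with_proj G) = with_proj G \<and>
         (\<forall>v \<in> pverts G. iso_verts h v = f v))"
    (is "?L \<longleftrightarrow> ?R")
proof
  interpret pair_wf_digraph G by fact
  assume L: ?L
  then have f: "f \<in> extensional (pverts G)" "inj_on f (pverts G)" "f ` pverts G = pverts G"
    and arcs: "\<And>u v. u \<in> pverts G \<Longrightarrow> v \<in> pverts G \<Longrightarrow> (f u, f v) \<in> parcs G \<longleftrightarrow> (u, v) \<in> parcs G"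
    by (auto simp: digraph_auto_def Bij_def bij_betw_def)
  define h where "h = \<lparr>iso_verts = f, iso_arcs = map_prod f f, iso_head = snd, iso_tail = fst\<rparr>"
  have im: "map_prod f f ` parcs G = parcs G"
  proof (intro equalityI subsetI)
    fix e assume "e \<in> map_prod f f ` parcs G"
    then show "e \<in> parcs G" using arcs in_arcsD1 in_arcsD2 by fastforce
  next
    fix e assume e: "e \<in> parcs G"
    obtain a b where ab: "e = (a, b)" by force
    then have "a \<in> f ` pverts G" "b \<in> f ` pverts G"
      using e f(3) in_arcsD1 in_arcsD2 by auto
    then obtain u v where "u \<in> pverts G" "v \<in> pverts G" "a = f u" "b = f v" by blast
    then show "e \<in> map_prod f f ` parcs G"
      using e ab arcs by (force simp: image_iff)
  qed
  have inj: "inj_on (map_prod f f) (parcs G)"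
    by (rule inj_on_subset[OF map_prod_inj_on[OF f(2) f(2)]]) (auto dest: in_arcsD1 in_arcsD2)
  have "wf_digraph (with_proj G)" by unfold_locales
  then have "pre_digraph.digraph_isomorphism (with_proj G) h"
    using f(2) inj by (simp add: pre_digraph.digraph_isomorphism_def h_def)
  moreover have "app_iso h (with_proj G) = with_proj G"
    using f(3) im by (simp add: app_iso_def h_def with_proj_def)
  ultimately show ?R using f(1) by (auto simp: h_def intro!: exI[of _ h])
next
  interpret pair_wf_digraph G by fact
  assume ?R
  then obtain h where f: "f \<in> extensional (pverts G)"
    and iso: "pre_digraph.digraph_isomorphism (with_proj G) h"
    and app: "app_iso h (with_proj G) = with_proj G"
    and hf: "\<And>v. v \<in> pverts G \<Longrightarrow> iso_verts h v = f v"
    by blast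
  from app have V: "iso_verts h ` pverts G = pverts G" and A: "iso_arcs h ` parcs G = parcs G"
    and ht: "iso_tail h = fst" "iso_head h = snd"
    by (auto simp: app_iso_def with_proj_def)
  from iso have injV: "inj_on (iso_verts h) (pverts G)"
    and ends: "\<And>e. e \<in> parcs G \<Longrightarrow> iso_arcs h e = (iso_verts h (fst e), iso_verts h (snd e))"
    by (auto simp: pre_digraph.digraph_isomorphism_def ht prod_eq_iff)
  have injf: "inj_on f (pverts G)" using injV hf by (simp cong: inj_on_cong)
  have "f ` pverts G = pverts G" using V hf by (simp cong: image_cong)
  with f injf have B: "f \<in> Bij (pverts G)" by (simp add: Bij_def bij_betw_def)
  have "(f u, f v) \<in> parcs G \<longleftrightarrow> (u, v) \<in> parcs G" if uv: "u \<in> pverts G" "v \<in> pverts G" for u v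
  proof
    assume "(u, v) \<in> parcs G"
    then have "iso_arcs h (u, v) \<in> parcs G" using A by blast
    then show "(f u, f v) \<in> parcs G" using ends[OF \<open>(u, v) \<in> parcs G\<close>] hf uv by simp
  next
    assume "(f u, f v) \<in> parcs G"
    then have "(f u, f v) \<in> iso_arcs h ` parcs G" by (simp only: A)
    then obtain e where e: "e \<in> parcs G" "iso_arcs h e = (f u, f v)" by (metis imageE)
    obtain a b where ab: "e = (a, b)" by force
    then have "a \<in> pverts G" "b \<in> pverts G" using e in_arcsD1 in_arcsD2 by auto
    moreover from this have "f a = f u" "f b = f v" using ends[OF e(1)] e(2) ab hf by auto
    ultimately have "a = u" "b = v" using injf uv by (auto dest: inj_onD)
    then show "(u, v) \<in> parcs G" using e ab by simp
  qed
  with B show ?L by (simp add: digraph_auto_def)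
qed

end

theory Submission
  imports Defs
begin

text \<open>
  The loops of \<^term>\<open>Gkw k w\<close> sit at the vertices \<open>(x, 0)\<close>. An arc out of \<open>(p, 0)\<close> keeps the first
  coordinate, because the increment \<open>w ^ j * 0\<close> vanishes, and the only arc from \<open>(p, i)\<close> to a
  vertex with second coordinate \<open>0\<close> adds \<open>w ^ 0 * i = i\<close> to the first. So \<open>(p, i)\<close> is
  the one vertex that has \<open>(p, 0)\<close> as an in-neighbour and \<open>(p + i, 0)\<close> as an out-neighbour
  (\<open>Gkw_vertex_between_idempotents\<close>). Being the only vertex between two given idempotents is
  preserved by automorphisms, hence an automorphism is known once its values on the idempotents are
  (\<open>digraph_auto_eqI_idempotents\<close>).

  An automorphism maps loops to loops, so after numbering the \<open>k\<close> idempotents by \<open>{1..k}\<close> it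
  induces a permutation of \<open>{1..k}\<close>. This is a group homomorphism into \<^term>\<open>sym_group k\<close>,
  injective by the first part, and an injective homomorphism is an isomorphism onto its image
  (\<open>digraph_AutoGroup_iso_subgroup_sym_group\<close>).
\<close>

lemma digraph_auto_bij_betw_verts:
  "f \<in> digraph_auto G \<Longrightarrow> bij_betw f (pverts G) (pverts G)"
  by (simp add: digraph_auto_def Bij_def)

lemma digraph_auto_arc_iff:
  "f \<in> digraph_auto G \<Longrightarrow> u \<in> pverts G \<Longrightarrow> v \<in> pverts G \<Longrightarrow>
    (f u, f v) \<in> parcs G \<longleftrightarrow> (u, v) \<in> parcs G"
  by (simp add: digraph_auto_def)

lemma idempotent_verts_subset: "idempotent_verts G \<subseteq> pverts G"
  by (auto simp: idempotent_verts_def)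

lemma digraph_auto_bij_betw_idempotents:
  assumes f: "f \<in> digraph_auto G"
  shows "bij_betw f (idempotent_verts G) (idempotent_verts G)"
proof (rule bij_betw_subset[OF digraph_auto_bij_betw_verts[OF f] idempotent_verts_subset])
  have V: "f ` pverts G = pverts G"
    using digraph_auto_bij_betw_verts[OF f] by (simp add: bij_betw_def)
  show "f ` idempotent_verts G = idempotent_verts G"
  proof (intro equalityI subsetI)
    fix y assume "y \<in> f ` idempotent_verts G"
    then show "y \<in> idempotent_verts G"
      using V digraph_auto_arc_iff[OF f] by (auto simp: idempotent_verts_def)
  next
    fix y assume y: "y \<in> idempotent_verts G"
    then obtain x where "x \<in> pverts G" "y = f x"
      using V by (auto simp: idempotent_verts_def)
    then show "y \<in> f ` idempotent_verts G"
      using y digraph_auto_arc_iff[OF f] by (auto simp: idempotent_verts_def)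
  qed
qed

text \<open>
  If \<open>u\<close> is the only vertex between the idempotents \<open>a\<close> and \<open>b\<close>, then \<open>g u\<close> is the only vertex
  between \<open>g a = f a\<close> and \<open>g b = f b\<close>; but \<open>f u\<close> lies between them too.
\<close>

lemma digraph_auto_eqI_idempotents:
  assumes f: "f \<in> digraph_auto G" and g: "g \<in> digraph_auto G"
    and agree: "\<And>v. v \<in> idempotent_verts G \<Longrightarrow> f v = g v"
    and between: "\<And>u. u \<in> pverts G \<Longrightarrow>
      \<exists>a \<in> idempotent_verts G. \<exists>b \<in> idempotent_verts G.
        \<forall>v \<in> pverts G. (a, v) \<in> parcs G \<and> (v, b) \<in> parcs G \<longleftrightarrow> v = u"
  shows "f = g"
proof (rule extensionalityI[where A = "pverts G"])
  show "f \<in> extensional (pverts G)" "g \<in> extensional (pverts G)"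
    using f g by (simp_all add: digraph_auto_def Bij_def)
next
  fix u assume u: "u \<in> pverts G"
  obtain a b where ab: "a \<in> idempotent_verts G" "b \<in> idempotent_verts G"
    and only: "\<And>v. v \<in> pverts G \<Longrightarrow> (a, v) \<in> parcs G \<and> (v, b) \<in> parcs G \<longleftrightarrow> v = u"
    using between[OF u] by blast
  have abV: "a \<in> pverts G" "b \<in> pverts G"
    using ab by (simp_all add: idempotent_verts_def)
  obtain u' where u': "u' \<in> pverts G" "f u = g u'"
    using digraph_auto_bij_betw_verts[OF f] digraph_auto_bij_betw_verts[OF g] u
    by (metis bij_betw_apply bij_betw_imp_surj_on imageE)
  have "(f a, f u) \<in> parcs G" "(f u, f b) \<in> parcs G"
    using only[OF u] digraph_auto_arc_iff[OF f] abV u by auto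
  then have "(g a, g u') \<in> parcs G" "(g u', g b) \<in> parcs G"
    using agree ab u'(2) by auto
  then have "u' = u"
    using only[OF u'(1)] digraph_auto_arc_iff[OF g] abV u'(1) by auto
  then show "f u = g u"
    using u'(2) by simp
qed

lemma Gkw_arc_iff:
  "((p, i), (q, j)) \<in> parcs (Gkw k w) \<longleftrightarrow>
    p < k \<and> i < k \<and> j < k \<and> q = (p + w ^ j * i) mod k"
  by (auto simp: Gkw_def)

lemma Gkw_vertex_between_idempotents:
  assumes "coprime k w" and "k > 0" and u: "u \<in> pverts (Gkw k w)"
  shows "\<exists>a \<in> idempotent_verts (Gkw k w). \<exists>b \<in> idempotent_verts (Gkw k w).
    \<forall>v \<in> pverts (Gkw k w).
      (a, v) \<in> parcs (Gkw k w) \<and> (v, b) \<in> parcs (Gkw k w) \<longleftrightarrow> v = u"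
proof -
  obtain p i where pi: "u = (p, i)" "p < k" "i < k"
    using u by (auto simp: Gkw_def)
  have cancel: "j = i" if "(p + j) mod k = (p + i) mod k" "j < k" for j
  proof -
    have "[p + j = p + i] (mod k)"
      using that by (simp add: cong_def)
    then have "[j = i] (mod k)"
      by (simp only: cong_add_lcancel_nat)
    then show ?thesis
      using that pi by (simp add: cong_def)
  qed
  show ?thesis
  proof (rule bexI[where x = "(p, 0)"], rule bexI[where x = "((p + i) mod k, 0)"], rule ballI)
    show "(p, 0) \<in> idempotent_verts (Gkw k w)" "((p + i) mod k, 0) \<in> idempotent_verts (Gkw k w)"
      using assms pi by (auto simp: idempotent_verts_Gkw)
  next
    fix v assume "v \<in> pverts (Gkw k w)"
    then obtain q j where v: "v = (q, j)" "q < k" "j < k"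
      by (auto simp: Gkw_def)
    have "((p, 0), v) \<in> parcs (Gkw k w) \<longleftrightarrow> q = p"
      using v pi by (simp add: Gkw_arc_iff)
    moreover have "(v, ((p + i) mod k, 0)) \<in> parcs (Gkw k w) \<longleftrightarrow> (q + j) mod k = (p + i) mod k"
      using v pi by (auto simp: Gkw_arc_iff)
    ultimately show "((p, 0), v) \<in> parcs (Gkw k w) \<and> (v, ((p + i) mod k, 0)) \<in> parcs (Gkw k w)
        \<longleftrightarrow> v = u"
      using cancel[of j] v pi by auto
  qed
qed

lemma inj_hom_imp_iso_image_subgroup:
  assumes "group G" "group H" "h \<in> hom G H" "inj_on h (carrier G)"
  shows "\<exists>K. subgroup K H \<and> G \<cong> H\<lparr>carrier := K\<rparr>"
proof -
  interpret group_hom G H h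
    using assms by (simp add: group_hom_def group_hom_axioms_def)
  have "h \<in> iso G (H\<lparr>carrier := h ` carrier G\<rparr>)"
    using assms by (auto simp: iso_def hom_def bij_betw_def)
  then show ?thesis
    using img_is_subgroup is_isoI by blast
qed

text \<open>
  The action on the idempotents, transported along a numbering \<open>b\<close> of them, is a homomorphism to
  the symmetric group; its kernel is trivial when automorphisms are determined by that action.
\<close>

lemma digraph_AutoGroup_iso_subgroup_sym_group:
  assumes b: "bij_betw b (idempotent_verts G) {1..n}"
    and determined: "\<And>f g. f \<in> digraph_auto G \<Longrightarrow> g \<in> digraph_auto G \<Longrightarrow>
      \<forall>v \<in> idempotent_verts G. f v = g v \<Longrightarrow> f = g"
  shows "\<exists>H. subgroup H (sym_group n) \<and>
    digraph_AutoGroup G \<cong> (sym_group n)\<lparr>carrier := H\<rparr>"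
proof (rule inj_hom_imp_iso_image_subgroup)
  let ?I = "idempotent_verts G"
  define c where "c = inv_into ?I b"
  define h where "h = (\<lambda>f m. if m \<in> {1..n} then b (f (c m)) else m)"
  have c: "bij_betw c {1..n} ?I"
    unfolding c_def by (rule bij_betw_inv_into[OF b])
  have cI: "c m \<in> ?I" if "m \<in> {1..n}" for m
    using c that by (rule bij_betw_apply)
  have cb: "c (b v) = v" if "v \<in> ?I" for v
    unfolding c_def using b that by (rule bij_betw_inv_into_left)
  have bI: "b v \<in> {1..n}" if "v \<in> ?I" for v
    using b that by (rule bij_betw_apply)
  have fI: "f v \<in> ?I" if "f \<in> digraph_auto G" "v \<in> ?I" for f v
    using digraph_auto_bij_betw_idempotents[OF that(1)] that(2) by (rule bij_betw_apply)
  have h_mem: "h f permutes {1..n}" if f: "f \<in> digraph_auto G" for f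
  proof (rule bij_imp_permutes)
    have "bij_betw (b \<circ> (f \<circ> c)) {1..n} {1..n}"
      by (rule bij_betw_trans[OF bij_betw_trans[OF c digraph_auto_bij_betw_idempotents[OF f]] b])
    then show "bij_betw (h f) {1..n} {1..n}"
      by (rule iffD1[OF bij_betw_cong, rotated]) (simp add: h_def)
  qed (auto simp: h_def)
  have h_mult: "h (compose (pverts G) f g) = h f \<circ> h g"
    if "f \<in> digraph_auto G" "g \<in> digraph_auto G" for f g
  proof
    fix m
    show "h (compose (pverts G) f g) m = (h f \<circ> h g) m"
    proof (cases "m \<in> {1..n}")
      case True
      have "c m \<in> pverts G"
        using cI[OF True] by (rule subsetD[OF idempotent_verts_subset])
      moreover have gc: "g (c m) \<in> ?I"
        by (rule fI[OF that(2) cI[OF True]])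
      ultimately show ?thesis
        using True bI[OF gc] cb[OF gc] by (simp add: h_def compose_eq)
    qed (auto simp: h_def)
  qed
  have mult: "f \<otimes>\<^bsub>digraph_AutoGroup G\<^esub> g = compose (pverts G) f g"
    if "f \<in> digraph_auto G" "g \<in> digraph_auto G" for f g
    using that by (simp add: digraph_AutoGroup_def BijGroup_def digraph_auto_def)
  have carrier: "carrier (digraph_AutoGroup G) = digraph_auto G"
    by (simp add: digraph_AutoGroup_def)
  show "h \<in> hom (digraph_AutoGroup G) (sym_group n)"
    using h_mem by (simp add: hom_def Pi_def carrier sym_group_def h_mult mult)
  show "inj_on h (carrier (digraph_AutoGroup G))"
    unfolding carrier
  proof (rule inj_onI)
    fix f g assume f: "f \<in> digraph_auto G" and g: "g \<in> digraph_auto G" and eq: "h f = h g"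
    have "f v = g v" if v: "v \<in> ?I" for v
    proof -
      have "b (f v) = b (g v)"
        using fun_cong[OF eq, of "b v"] bI[OF v] cb[OF v] by (simp add: h_def)
      with bij_betw_imp_inj_on[OF b] show ?thesis
        by (rule inj_onD) (rule fI[OF f v], rule fI[OF g v])
    qed
    then show "f = g"
      using determined[OF f g] by blast
  qed
qed (rule group_digraph_AutoGroup, rule sym_group_is_group)

theorem theorem4:
  fixes k c w :: nat
  assumes "k > 0"
    and "w < k"
    and "coprime k w"
    and "ord k w = c"
    and "c dvd k"
  shows "(\<forall>f \<in> digraph_auto (Gkw k w). \<forall>g \<in> digraph_auto (Gkw k w).
            (\<forall>v \<in> idempotent_verts (Gkw k w). f v = g v) \<longrightarrow> f = g) \<and>
         (\<exists>H. subgroup H (sym_group k) \<and>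
            digraph_AutoGroup (Gkw k w) \<cong> (sym_group k)\<lparr>carrier := H\<rparr>)"
proof -
  have determined: "f = g"
    if "f \<in> digraph_auto (Gkw k w)" "g \<in> digraph_auto (Gkw k w)"
      "\<forall>v \<in> idempotent_verts (Gkw k w). f v = g v" for f g
    using that Gkw_vertex_between_idempotents[OF assms(3,1)]
    by (intro digraph_auto_eqI_idempotents[of f "Gkw k w" g]) auto
  have "bij_betw (\<lambda>v. Suc (fst v)) (idempotent_verts (Gkw k w)) {1..k}"
    unfolding idempotent_verts_Gkw[OF assms(3,1)]
    by (rule bij_betw_byWitness[where f' = "\<lambda>m. (m - 1, 0)"]) auto
  then show ?thesis
    using digraph_AutoGroup_iso_subgroup_sym_group[of _ "Gkw k w" k] determined by blast
qed

end
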